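(* Let $g_k\in\mathbb{R}^n\setminus\{0\}$, let $B_k\in\mathbb{R}^{n\times n}$ be symmetric, let $\sigma_k>0$, and let $s_k^Q$ be a stationary point of the quadratic model $m_k^Q$ over the subspace $\mathcal{L}_k$ (with basis matrix $Q_k$), with $g_k^\top s_k^Q\ne 0$ and $|g_k^\top s_k^Q|\ge\epsilon_d\|g_k\|\,\|s_k^Q\|$ for a constant $\epsilon_d>0$. Let $M_k$ be a symmetric positive definite matrix which satisfies $$M_ks_k^Q=\frac{\theta_k}{g_k^\top s_k^Q}\,g_k$$ for a fixed $\theta_k>0$, and let $s_k^{N}$ be the Newton-like step defined in the context. If the matrix $Q_k^\top\big(B_k+\sigma_k\|s_k^{N}\|_{M_k}M_k\big)Q_k$ is positive definite, then $s_k^{N}$ is the unique (global) minimizer over the subspace $\mathcal{L}_k$ of the cubic model $m_k$.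
   Context: Norms: $\|\cdot\|$ is the Euclidean norm and $\|x\|_{M_k}=\sqrt{x^\top M_kx}$. Here $f:\mathbb{R}^n\to\mathbb{R}$ is continuously differentiable, $x_k\in\mathbb{R}^n$ is the current iterate and $g_k=\nabla f(x_k)\neq0$. Models: $m_k^Q(s)=f(x_k)+s^\top g_k+\tfrac12 s^\top B_ks$ and $m_k(s)=m_k^Q(s)+\tfrac13\sigma_k\|s\|_{M_k}^3$. Subspace: $\mathcal{L}_k\subseteq\mathbb{R}^n$ is a linear subspace of dimension $l$ and $Q_k\in\mathbb{R}^{n\times l}$ has columns forming a basis of $\mathcal{L}_k$; $s_k^Q$ being a stationary point of $m_k^Q$ over $\mathcal{L}_k$ means $s_k^Q\in\mathcal{L}_k$ and $Q_k^\top(g_k+B_ks_k^Q)=0$. The exact case is $\mathcal{L}_k=\mathbb{R}^n$, $Q_k=I_n$, $B_ks_k^Q=-g_k$. Newton-like step: $s_k^{N}=\delta_k^{N}s_k^Q$, where $\delta_k^{N}=\arg\min_{\delta\in\mathcal{I}_k}m_k(\delta s_k^Q)$, with $\mathcal{I}_k=[0,\infty)$ if $g_k^\top s_k^Q<0$ and $\mathcal{I}_k=(-\infty,0]$ otherwise. *)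

theory Defs
  imports "HOL-Analysis.Analysis"
begin

definition pos_def :: "real^'n^'n \<Rightarrow> bool" where
  "pos_def A \<longleftrightarrow> (\<forall>v. v \<noteq> 0 \<longrightarrow> 0 < v \<bullet> (A *v v))"

definition mat_norm :: "real^'n^'n \<Rightarrow> real^'n \<Rightarrow> real" where
  "mat_norm M v = sqrt (v \<bullet> (M *v v))"

definition quad_model :: "real \<Rightarrow> real^'n \<Rightarrow> real^'n^'n \<Rightarrow> real^'n \<Rightarrow> real" where
  "quad_model f0 g B s = f0 + s \<bullet> g + 1 / 2 * (s \<bullet> (B *v s))"

definition cubic_model ::
    "real \<Rightarrow> real^'n \<Rightarrow> real^'n^'n \<Rightarrow> real \<Rightarrow> real^'n^'n \<Rightarrow> real^'n \<Rightarrow> real" where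
  "cubic_model f0 g B \<sigma> M s = quad_model f0 g B s + 1 / 3 * \<sigma> * mat_norm M s ^ 3"

text \<open>\<^term>\<open>columns Q\<close> is a set, so injectivity is needed to exclude repeated columns.\<close>

definition basis_matrix :: "real^'l^'n \<Rightarrow> (real^'n) set \<Rightarrow> bool" where
  "basis_matrix Q L \<longleftrightarrow>
     inj (\<lambda>j. column j Q) \<and> independent (columns Q) \<and> span (columns Q) = L"

text \<open>The vector \<^term>\<open>g + B *v s\<close> is the gradient at \<^term>\<open>s\<close> of the quadratic model when
  \<^term>\<open>B\<close> is symmetric; the projected gradient onto the subspace has to vanish.\<close>

definition quad_stationary ::
    "real^'l^'n \<Rightarrow> (real^'n) set \<Rightarrow> real^'n \<Rightarrow> real^'n^'n \<Rightarrow> real^'n \<Rightarrow> bool" where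
  "quad_stationary Q L g B s \<longleftrightarrow> s \<in> L \<and> transpose Q *v (g + B *v s) = 0"

definition step_interval :: "real^'n \<Rightarrow> real^'n \<Rightarrow> real set" where
  "step_interval g sQ = (if g \<bullet> sQ < 0 then {0..} else {..0})"

text \<open>\<^const>\<open>arg_min_on\<close> is a choice operator, meaningful only where a minimizer exists. For
  \<open>g \<bullet> sQ \<noteq> 0\<close>, \<open>\<sigma> > 0\<close> and \<open>M\<close> positive definite the minimizer exists and is unique: along
  the ray the model has nonzero initial slope, of descent direction, and a cubic term that
  dominates at infinity.\<close>

definition newton_step ::
    "real \<Rightarrow> real^'n \<Rightarrow> real^'n^'n \<Rightarrow> real \<Rightarrow> real^'n^'n \<Rightarrow> real^'n \<Rightarrow> real^'n" where
  "newton_step f0 g B \<sigma> M sQ =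
     arg_min_on (\<lambda>\<delta>. cubic_model f0 g B \<sigma> M (\<delta> *\<^sub>R sQ)) (step_interval g sQ) *\<^sub>R sQ"

end

theory Submission
  imports Defs
begin

text \<open>The condition \<open>M *v sQ = (\<theta> / (g \<bullet> sQ)) *\<^sub>R g\<close> makes the gradient of the cubic term at a
  multiple of \<open>sQ\<close> parallel to \<open>g\<close>, as is, on \<open>L\<close>, the gradient of the quadratic model. Hence
  stationarity of the cubic model along the ray already gives stationarity over all of \<open>L\<close>.
  Writing \<open>r = mat_norm M sN\<close> and \<open>H = B + (\<sigma> * r) *\<^sub>R M\<close>, the cubic model is the quadratic
  \<open>s \<bullet> g + 1/2 * (s \<bullet> (H *v s))\<close>, strictly convex on \<open>L\<close> with stationary point \<open>sN\<close>, plus the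
  remainder \<open>\<sigma> * (\<rho>^3 / 3 - r * \<rho>\<^sup>2 / 2)\<close> with \<open>\<rho> = mat_norm M s\<close>, which is minimal over
  \<open>\<rho> \<ge> 0\<close> at \<open>\<rho> = r\<close>.\<close>

text \<open>Strictness leaves the choice operator a single admissible value.\<close>

lemma arg_min_on_eqI:
  fixes p :: "'a \<Rightarrow> 'b::order"
  assumes "k \<in> S" and "\<And>u. u \<in> S \<Longrightarrow> u \<noteq> k \<Longrightarrow> p k < p u"
  shows "arg_min_on p S = k"
  unfolding arg_min_on_def arg_min_def is_arg_min_def
proof (rule some_equality)
  show "k \<in> S \<and> (\<nexists>y. y \<in> S \<and> p y < p k)"
    using assms by (metis order.asym order.irrefl)
  show "u = k" if "u \<in> S \<and> (\<nexists>y. y \<in> S \<and> p y < p u)" for u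
    using assms that by metis
qed

text \<open>A critical point \<open>t\<close> is a double root of the difference between the cubic
  and its value at \<open>t\<close>; the remaining linear cofactor is positive on
  \<open>u \<ge> 0\<close>.\<close>

lemma cubic_half_line_minimum:
  fixes a b K :: real
  assumes "a > 0" "K > 0"
  obtains t where "t > 0" "3 * K * t\<^sup>2 + 2 * b * t = a"
    "\<And>u. u \<ge> 0 \<Longrightarrow> u \<noteq> t \<Longrightarrow> - a * t + b * t\<^sup>2 + K * t ^ 3 < - a * u + b * u\<^sup>2 + K * u ^ 3"
proof
  define r where "r = sqrt (b\<^sup>2 + 3 * K * a)"
  \<comment> \<open>The larger root of the derivative
    \<open>3 * K * t\<^sup>2 + 2 * b * t - a\<close>.\<close>
  define t where "t = (r - b) / (3 * K)"
  have r2: "r\<^sup>2 = b\<^sup>2 + 3 * K * a"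
    unfolding r_def using assms by simp
  have "\<bar>b\<bar> < r"
    unfolding r_def using assms by (intro real_less_rsqrt) auto
  then show t0: "t > 0"
    unfolding t_def using assms by simp
  have r: "r = 3 * K * t + b"
    unfolding t_def using assms by simp
  have "3 * K * (3 * K * t\<^sup>2 + 2 * b * t) = r\<^sup>2 - b\<^sup>2"
    unfolding r by algebra
  then have "3 * K * (3 * K * t\<^sup>2 + 2 * b * t) = 3 * K * a"
    using r2 by simp
  then show root: "3 * K * t\<^sup>2 + 2 * b * t = a"
    using assms by simp
  fix u :: real
  assume u: "u \<ge> 0" "u \<noteq> t"
  have "t * (3 * K * t + 2 * b) > 0"
    using root assms by (simp add: power2_eq_square algebra_simps)
  then have "3 * K * t + 2 * b > 0"
    using t0 by (simp add: zero_less_mult_iff)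
  moreover have "K * t > 0" "K * u \<ge> 0"
    using t0 u assms by simp_all
  \<comment> \<open>Twice the left side is
    \<open>(3 * K * t + 2 * b) + K * t + 2 * K * u\<close>.\<close>
  ultimately have "b + K * (u + 2 * t) > 0"
    by (simp add: algebra_simps)
  then have "(u - t)\<^sup>2 * (b + K * (u + 2 * t)) > 0"
    using u by simp
  moreover have "(u - t)\<^sup>2 * (b + K * (u + 2 * t)) =
      (- a * u + b * u\<^sup>2 + K * u ^ 3) - (- a * t + b * t\<^sup>2 + K * t ^ 3)"
    unfolding root[symmetric] by algebra
  ultimately show "- a * t + b * t\<^sup>2 + K * t ^ 3 < - a * u + b * u\<^sup>2 + K * u ^ 3"
    by simp
qed

text \<open>The half line lies on the descent side, so passing to \<open>\<bar>u\<bar>\<close>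
  reduces both signs of \<open>d\<close> to slope \<open>- \<bar>d\<bar>\<close> on
  \<open>u \<ge> 0\<close>. The minimizer is interior, hence the derivative vanishes there.\<close>

lemma cubic_ray_stationary:
  fixes b c d K :: real
  assumes "d \<noteq> 0" "K > 0"
  defines "\<delta> \<equiv> arg_min_on (\<lambda>u. c + d * u + b * u\<^sup>2 + K * \<bar>u\<bar> ^ 3) (if d < 0 then {0..} else {..0})"
  shows "d + 2 * b * \<delta> + 3 * K * \<bar>\<delta>\<bar> * \<delta> = 0"
proof -
  have "\<bar>d\<bar> > 0"
    using assms by simp
  from cubic_half_line_minimum[OF this \<open>K > 0\<close>, of b]
  obtain t where t: "t > 0" "3 * K * t\<^sup>2 + 2 * b * t = \<bar>d\<bar>"
    "\<And>u. u \<ge> 0 \<Longrightarrow> u \<noteq> t \<Longrightarrow> - \<bar>d\<bar> * t + b * t\<^sup>2 + K * t ^ 3 < - \<bar>d\<bar> * u + b * u\<^sup>2 + K * u ^ 3"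
    by blast
  have "\<delta> = - sgn d * t"
    unfolding \<delta>_def
  proof (rule arg_min_on_eqI)
    show "- sgn d * t \<in> (if d < 0 then {0..} else {..0})"
      using t(1) assms(1) by (auto simp: sgn_if)
    fix u assume "u \<in> (if d < 0 then {0..} else {..0})" "u \<noteq> - sgn d * t"
    then have "\<bar>u\<bar> \<noteq> t" and "- \<bar>d\<bar> * \<bar>u\<bar> = d * u"
      using assms(1) by (auto simp: sgn_if split: if_splits)
    then have "- \<bar>d\<bar> * t + b * t\<^sup>2 + K * t ^ 3 < d * u + b * u\<^sup>2 + K * \<bar>u\<bar> ^ 3"
      using t(3)[of "\<bar>u\<bar>"] by simp
    then show "c + d * (- sgn d * t) + b * (- sgn d * t)\<^sup>2 + K * \<bar>- sgn d * t\<bar> ^ 3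
        < c + d * u + b * u\<^sup>2 + K * \<bar>u\<bar> ^ 3"
      using t(1) assms(1) by (auto simp: sgn_if split: if_splits)
  qed
  with t(1,2) assms(1) show ?thesis
    by (auto simp: sgn_if power2_eq_square algebra_simps split: if_splits)
qed

lemma mat_norm_scaleR: "mat_norm M (c *\<^sub>R v) = \<bar>c\<bar> * mat_norm M v"
  by (simp add: mat_norm_def matrix_vector_mult_scaleR real_sqrt_mult flip: mult.assoc)

lemma pos_def_nonneg: "pos_def M \<Longrightarrow> 0 \<le> v \<bullet> (M *v v)"
  by (cases "v = 0") (auto simp: pos_def_def less_imp_le)

lemma mat_norm_nonneg: "pos_def M \<Longrightarrow> 0 \<le> mat_norm M v"
  by (simp add: mat_norm_def pos_def_nonneg)

lemma mat_norm_power2: "pos_def M \<Longrightarrow> (mat_norm M v)\<^sup>2 = v \<bullet> (M *v v)"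
  by (simp add: mat_norm_def pos_def_nonneg)

lemma newton_step_stationary:
  assumes "\<sigma> > 0" "pos_def M" "g \<bullet> s \<noteq> 0"
  obtains \<delta> where "newton_step f0 g B \<sigma> M s = \<delta> *\<^sub>R s"
    "g \<bullet> s + \<delta> * (s \<bullet> (B *v s)) + \<sigma> * \<bar>\<delta>\<bar> * \<delta> * mat_norm M s ^ 3 = 0"
proof
  define \<delta> where
    "\<delta> = arg_min_on (\<lambda>u. cubic_model f0 g B \<sigma> M (u *\<^sub>R s)) (step_interval g s)"
  have "s \<noteq> 0"
    using assms by auto
  then have "mat_norm M s > 0"
    using \<open>pos_def M\<close> by (simp add: mat_norm_def pos_def_def)
  then have K: "\<sigma> * mat_norm M s ^ 3 / 3 > 0"
    using \<open>\<sigma> > 0\<close> by simp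
  \<comment> \<open>Homogeneity of the norm makes the model on the ray a cubic in \<open>u\<close>
    and \<open>\<bar>u\<bar>\<close>.\<close>
  have model: "cubic_model f0 g B \<sigma> M (u *\<^sub>R s) =
      f0 + (g \<bullet> s) * u + (s \<bullet> (B *v s) / 2) * u\<^sup>2 + (\<sigma> * mat_norm M s ^ 3 / 3) * \<bar>u\<bar> ^ 3" for u
    by (simp add: cubic_model_def quad_model_def mat_norm_scaleR matrix_vector_mult_scaleR
        inner_commute[of s g] power2_eq_square power_mult_distrib mult_ac)
  have "(g \<bullet> s) + 2 * (s \<bullet> (B *v s) / 2) * \<delta>
      + 3 * (\<sigma> * mat_norm M s ^ 3 / 3) * \<bar>\<delta>\<bar> * \<delta> = 0"
    unfolding \<delta>_def step_interval_def model by (rule cubic_ray_stationary[OF assms(3) K])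
  then show "g \<bullet> s + \<delta> * (s \<bullet> (B *v s)) + \<sigma> * \<bar>\<delta>\<bar> * \<delta> * mat_norm M s ^ 3 = 0"
    by (simp add: algebra_simps)
  show "newton_step f0 g B \<sigma> M s = \<delta> *\<^sub>R s"
    by (simp add: newton_step_def \<delta>_def)
qed

lemma span_columns_eq_range:
  fixes Q :: "real^'l^'n"
  shows "span (columns Q) = range ((*v) Q)"
proof
  have "column j Q \<in> range ((*v) Q)" for j
    by (metis matrix_vector_mult_basis rangeI)
  moreover have "subspace (range ((*v) Q))"
    by (simp add: linear_subspace_image)
  ultimately show "span (columns Q) \<subseteq> range ((*v) Q)"
    by (intro span_minimal) (auto simp: columns_def)
  show "range ((*v) Q) \<subseteq> span (columns Q)"
    using matrix_vector_mult_in_columnspace by blast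
qed

lemma inner_transpose_matrix_vector:
  fixes A :: "real^'l^'n"
  shows "w \<bullet> (transpose A *v v) = (A *v w) \<bullet> v"
  by (metis dot_lmul_matrix inner_commute transpose_matrix_vector transpose_transpose)

lemma basis_matrix_range: "basis_matrix Q L \<Longrightarrow> L = range ((*v) Q)"
  by (simp add: basis_matrix_def span_columns_eq_range)

text \<open>Substituting \<open>v = Q *v w\<close> moves \<open>Q\<close> across the inner product;
  \<open>w\<close> is nonzero because \<open>v\<close> is.\<close>

lemma pos_def_restrict_subspace:
  assumes "basis_matrix Q L" "pos_def (transpose Q ** H ** Q)" "v \<in> L" "v \<noteq> 0"
  shows "0 < v \<bullet> (H *v v)"
proof -
  obtain w where w: "v = Q *v w"
    using assms basis_matrix_range by blast
  then have "w \<noteq> 0"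
    using \<open>v \<noteq> 0\<close> by auto
  then have "0 < w \<bullet> ((transpose Q ** H ** Q) *v w)"
    using assms by (simp add: pos_def_def)
  then show ?thesis
    by (simp add: w inner_transpose_matrix_vector del: transpose_matrix_vector
        flip: matrix_vector_mul_assoc)
qed

lemma quad_stationary_orthogonal:
  assumes "basis_matrix Q L" "quad_stationary Q L g B s" "v \<in> L"
  shows "v \<bullet> (g + B *v s) = 0"
proof -
  obtain w where "v = Q *v w"
    using assms basis_matrix_range by blast
  then show ?thesis
    using assms by (simp add: quad_stationary_def del: transpose_matrix_vector
        flip: inner_transpose_matrix_vector)
qed

lemma symmetric_quadratic_expand:
  fixes A :: "real^'n^'n"
  assumes "transpose A = A"
  shows "s \<bullet> (A *v s) = z \<bullet> (A *v z) + 2 * ((s - z) \<bullet> (A *v z)) + (s - z) \<bullet> (A *v (s - z))"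
proof -
  \<comment> \<open>Symmetry merges the two cross terms of the expansion about
    \<open>z\<close>.\<close>
  have "z \<bullet> (A *v s) = s \<bullet> (A *v z)"
    by (metis assms inner_commute inner_transpose_matrix_vector)
  then show ?thesis
    by (simp add: matrix_vector_mult_diff_distrib inner_diff_left inner_diff_right)
qed

lemma cubic_model_strict_minimum:
  fixes B M :: "real^'n^'n"
  assumes "transpose B = B" "transpose M = M" "pos_def M" "\<sigma> \<ge> 0"
    and stat: "(s - z) \<bullet> (g + (B + (\<sigma> * mat_norm M z) *\<^sub>R M) *v z) = 0"
    and pos: "0 < (s - z) \<bullet> ((B + (\<sigma> * mat_norm M z) *\<^sub>R M) *v (s - z))"
  shows "cubic_model f0 g B \<sigma> M z < cubic_model f0 g B \<sigma> M s"
proof -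
  define r \<rho> H where "r = mat_norm M z" and "\<rho> = mat_norm M s"
    and "H = B + (\<sigma> * r) *\<^sub>R M"
  have symH: "transpose H = H"
    using assms by (simp add: H_def transpose_def vec_eq_iff)
  \<comment> \<open>The term \<open>\<sigma> * r * (mat_norm M v)\<^sup>2 / 2\<close> is added
    inside \<open>H\<close> and subtracted again in the remainder.\<close>
  have split: "cubic_model f0 g B \<sigma> M v = f0 + v \<bullet> g + v \<bullet> (H *v v) / 2
      + \<sigma> * (mat_norm M v ^ 3 / 3 - r * (mat_norm M v)\<^sup>2 / 2)" for v
    using \<open>pos_def M\<close> by (simp add: cubic_model_def quad_model_def H_def mat_norm_power2
        matrix_vector_mult_add_rdistrib inner_add_right scaleR_matrix_vector_assoc[symmetric] algebra_simps)
  \<comment> \<open>The remainder is stationary at \<open>\<rho> = r\<close>, hence the squared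
    factor; the cofactor is a sum of norms.\<close>
  have "(\<rho> ^ 3 / 3 - r * \<rho>\<^sup>2 / 2) - (r ^ 3 / 3 - r * r\<^sup>2 / 2) = (\<rho> - r)\<^sup>2 * (2 * \<rho> + r) / 6"
    by (simp add: power2_eq_square power3_eq_cube field_simps)
  also have "\<dots> \<ge> 0"
    using \<open>pos_def M\<close> by (simp add: r_def \<rho>_def mat_norm_nonneg)
  finally have "\<sigma> * (r ^ 3 / 3 - r * r\<^sup>2 / 2) \<le> \<sigma> * (\<rho> ^ 3 / 3 - r * \<rho>\<^sup>2 / 2)"
    using \<open>\<sigma> \<ge> 0\<close> by (intro mult_left_mono) simp_all
  \<comment> \<open>Strictness comes from here: expanding about \<open>z\<close>, stationarity
    removes the first-order part and leaves positive curvature.\<close>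
  moreover have "z \<bullet> g + z \<bullet> (H *v z) / 2 < s \<bullet> g + s \<bullet> (H *v s) / 2"
  proof -
    have "s \<bullet> g = z \<bullet> g + (s - z) \<bullet> g"
      by (simp add: inner_diff_left)
    moreover have "(s - z) \<bullet> g + (s - z) \<bullet> (H *v z) = 0"
      using stat by (simp add: inner_add_right flip: r_def H_def)
    moreover have "0 < (s - z) \<bullet> (H *v (s - z))"
      using pos by (simp flip: r_def H_def)
    ultimately show ?thesis
      using symmetric_quadratic_expand[OF symH, of s z] by linarith
  qed
  ultimately show ?thesis
    unfolding split by (simp flip: r_def \<rho>_def)
qed

theorem theorem3p3:
  fixes f :: "real^'n \<Rightarrow> real" and gradf :: "real^'n \<Rightarrow> real^'n"
    and x g sQ sN :: "real^'n"
    and B M :: "real^'n^'n"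
    and L :: "(real^'n) set" and Q :: "real^'l^'n"
    and \<sigma> \<theta> \<epsilon> :: real
  assumes "\<And>y. GDERIV f y :> gradf y" and "continuous_on UNIV gradf"
    and "g = gradf x" and "g \<noteq> 0"
    and "transpose B = B"
    and "\<sigma> > 0"
    and "subspace L" and "dim L = CARD('l)" and "basis_matrix Q L"
    and "quad_stationary Q L g B sQ"
    and "g \<bullet> sQ \<noteq> 0"
    and "\<epsilon> > 0" and "\<bar>g \<bullet> sQ\<bar> \<ge> \<epsilon> * norm g * norm sQ"
    and "transpose M = M" and "pos_def M"
    and "\<theta> > 0" and "M *v sQ = (\<theta> / (g \<bullet> sQ)) *\<^sub>R g"
    and "sN = newton_step (f x) g B \<sigma> M sQ"
    and "pos_def (transpose Q ** (B + (\<sigma> * mat_norm M sN) *\<^sub>R M) ** Q)"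
  shows "{s. is_arg_min (cubic_model (f x) g B \<sigma> M) (\<lambda>s. s \<in> L) s} = {sN}"
proof -
  note statQ = assms(10) and M_sQ = assms(17)
  define d where "d = g \<bullet> sQ"
  define n where "n = mat_norm M sQ"
  define r where "r = mat_norm M sN"
  have d: "d \<noteq> 0"
    using assms(11) by (simp add: d_def)
  have sQL: "sQ \<in> L"
    using statQ by (simp add: quad_stationary_def)
  have BsQ: "v \<bullet> (B *v sQ) = - (v \<bullet> g)" if "v \<in> L" for v
    using quad_stationary_orthogonal[OF assms(9) statQ that] by (simp add: inner_add_right)
  obtain \<delta> where \<delta>: "sN = \<delta> *\<^sub>R sQ"
    "g \<bullet> sQ + \<delta> * (sQ \<bullet> (B *v sQ)) + \<sigma> * \<bar>\<delta>\<bar> * \<delta> * mat_norm M sQ ^ 3 = 0"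
    using newton_step_stationary[OF assms(6,15,11)] assms(18) by metis
  \<comment> \<open>Testing the stationarity of \<open>sQ\<close> with \<open>sQ\<close> itself
    gives the curvature \<open>- d\<close> along the ray.\<close>
  have ray: "d - \<delta> * d + \<sigma> * \<bar>\<delta>\<bar> * \<delta> * n ^ 3 = 0"
    using \<delta>(2) BsQ[OF sQL] by (simp add: d_def n_def inner_commute)
  \<comment> \<open>Pairing the condition on \<open>M *v sQ\<close> with \<open>sQ\<close> cancels
    \<open>d\<close>.\<close>
  have n2: "n\<^sup>2 = \<theta>"
    using d by (simp add: n_def mat_norm_power2[OF assms(15)] M_sQ d_def inner_commute)
  have r: "r = \<bar>\<delta>\<bar> * n"
    by (simp add: r_def \<delta>(1) mat_norm_scaleR n_def)
  have sNL: "sN \<in> L"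
    using \<delta>(1) sQL assms(7) by (simp add: subspace_scale)
  have stat: "v \<bullet> (g + (B + (\<sigma> * r) *\<^sub>R M) *v sN) = 0" if "v \<in> L" for v
  proof -
    have "v \<bullet> (g + (B + (\<sigma> * r) *\<^sub>R M) *v sN)
        = v \<bullet> g + \<delta> * (v \<bullet> (B *v sQ)) + \<sigma> * r * (\<delta> * (\<theta> / d * (v \<bullet> g)))"
      by (simp add: \<delta>(1) M_sQ[folded d_def] matrix_vector_mult_add_rdistrib inner_add_right
          matrix_vector_mult_scaleR scaleR_matrix_vector_assoc[symmetric])
        (simp add: algebra_simps)
    \<comment> \<open>Every term is a multiple of \<open>v \<bullet> g\<close>, and
      \<open>r * \<theta> = \<bar>\<delta>\<bar> * n ^ 3\<close>, so the common factor is the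
      one-dimensional condition \<open>ray\<close>.\<close>
    also have "\<dots> = (v \<bullet> g) / d * (d - \<delta> * d + \<sigma> * \<bar>\<delta>\<bar> * \<delta> * n ^ 3)"
      unfolding r n2[symmetric] BsQ[OF that] using d
      by (simp add: field_simps power2_eq_square power3_eq_cube)
    finally show ?thesis
      by (simp add: ray)
  qed
  have "cubic_model (f x) g B \<sigma> M sN < cubic_model (f x) g B \<sigma> M s"
    if "s \<in> L" "s \<noteq> sN" for s
  proof (rule cubic_model_strict_minimum[OF assms(5,14,15)])
    have "s - sN \<in> L"
      using that sNL assms(7) by (simp add: subspace_diff)
    then show "(s - sN) \<bullet> (g + (B + (\<sigma> * mat_norm M sN) *\<^sub>R M) *v sN) = 0"
      and "0 < (s - sN) \<bullet> ((B + (\<sigma> * mat_norm M sN) *\<^sub>R M) *v (s - sN))"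
      using stat pos_def_restrict_subspace[OF assms(9,19)] that by (simp_all add: r_def)
  qed (use assms(6) in simp)
  with sNL have "is_arg_min (cubic_model (f x) g B \<sigma> M) (\<lambda>s. s \<in> L) s \<longleftrightarrow> s = sN" for s
    unfolding is_arg_min_def by (metis less_asym)
  then show ?thesis
    by simp
qed

end
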